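(* Let $R$ be a ring and let $\mathcal{F}$ be a right Oka family of right ideals of $R$ such that every nonempty chain of right ideals in $\mathcal{F}'$ (with respect to inclusion) has an upper bound in $\mathcal{F}'$. Then the following hold. (1) Let $\mathcal{F}_0$ be a semifilter of right ideals in $R$. If $\mathcal{F}$ is a point annihilator set for the class of modules $\{R/I : I \in \mathrm{Max}(\mathcal{F}') \cap \mathcal{F}_0\}$, then $\mathcal{F}_0 \subseteq \mathcal{F}$. (2) For any right ideal $J$ of $R$, if $\mathcal{F}$ is a point annihilator set for the class of modules $R/I$ such that $I \in \mathrm{Max}(\mathcal{F}')$ and $I \supseteq J$ (resp. $I \supsetneq J$), then all right ideals containing $J$ (resp. properly containing $J$) belong to $\mathcal{F}$. (3) If $\mathcal{F}$ is a point annihilator set for the class of modules $\{R/I : I \in \mathrm{Max}(\mathcal{F}')\}$, then $\mathcal{F}$ consists of all right ideals of $R$.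
   Context: Rings are associative with identity; modules are unital right modules. For a right ideal $I$ of $R$ and $a \in R$, $a^{-1}I := \{r \in R : ar \in I\}$. A family $\mathcal{F}$ of right ideals of $R$ is a right Oka family if $R \in \mathcal{F}$ and, for every $a \in R$ and every right ideal $I$ of $R$, $I + aR \in \mathcal{F}$ and $a^{-1}I \in \mathcal{F}$ imply $I \in \mathcal{F}$. For a family $\mathcal{F}$ of right ideals, $\mathcal{F}'$ denotes the set of right ideals of $R$ not in $\mathcal{F}$, and $\mathrm{Max}(\mathcal{F}')$ the set of right ideals that are maximal (under inclusion) in $\mathcal{F}'$. A semifilter is a family $\mathcal{F}_0$ of right ideals such that $J \in \mathcal{F}_0$ and $J \subseteq I$ ($I$ a right ideal) imply $I \in \mathcal{F}_0$. A point annihilator of a right module $M$ is the annihilator $\mathrm{ann}(m)=\{r\in R: mr=0\}$ of some nonzero $m \in M$. A set $\mathcal{S}$ of right ideals of $R$ is a point annihilator set for a class $\mathcal{C}$ of right $R$-modules if every nonzero $M \in \mathcal{C}$ has a point annihilator lying in $\mathcal{S}$ (members of $\mathcal{S}$ are not required to be point annihilators of modules in $\mathcal{C}$). *)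

theory Defs
  imports "HOL-Algebra.AbelCoset"
begin

text \<open>Rings are those of HOL-Algebra's locale \<^locale>\<open>ring\<close>: associative, with
  identity, not necessarily commutative, the zero ring included.\<close>

locale right_ideal = additive_subgroup I R + ring R for I and R (structure) +
  assumes I_r_closed: "\<lbrakk>a \<in> I; x \<in> carrier R\<rbrakk> \<Longrightarrow> a \<otimes> x \<in> I"

definition right_ideals :: "('a, 'r) ring_scheme \<Rightarrow> 'a set set"
  where "right_ideals R = {I. right_ideal I R}"

text \<open>The library's modules are left modules over commutative rings, so unital right
  modules over an arbitrary ring are introduced here. As there, the record extends
  \<^typ>\<open>'b ring\<close> and only its additive part is used.\<close>

record ('a, 'b) right_module = "'b ring" +
  rsmult :: "['b, 'a] \<Rightarrow> 'b" (infixl "\<bullet>\<index>" 70)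

locale right_module = R?: ring + M?: abelian_group M for M (structure) +
  assumes rsmult_closed [simp, intro]:
      "\<lbrakk>x \<in> carrier M; a \<in> carrier R\<rbrakk> \<Longrightarrow> x \<bullet>\<^bsub>M\<^esub> a \<in> carrier M"
    and rsmult_r_distr:
      "\<lbrakk>x \<in> carrier M; a \<in> carrier R; b \<in> carrier R\<rbrakk> \<Longrightarrow>
        x \<bullet>\<^bsub>M\<^esub> (a \<oplus> b) = x \<bullet>\<^bsub>M\<^esub> a \<oplus>\<^bsub>M\<^esub> x \<bullet>\<^bsub>M\<^esub> b"
    and rsmult_l_distr:
      "\<lbrakk>x \<in> carrier M; y \<in> carrier M; a \<in> carrier R\<rbrakk> \<Longrightarrow>
        (x \<oplus>\<^bsub>M\<^esub> y) \<bullet>\<^bsub>M\<^esub> a = x \<bullet>\<^bsub>M\<^esub> a \<oplus>\<^bsub>M\<^esub> y \<bullet>\<^bsub>M\<^esub> a"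
    and rsmult_assoc:
      "\<lbrakk>x \<in> carrier M; a \<in> carrier R; b \<in> carrier R\<rbrakk> \<Longrightarrow>
        x \<bullet>\<^bsub>M\<^esub> (a \<otimes> b) = (x \<bullet>\<^bsub>M\<^esub> a) \<bullet>\<^bsub>M\<^esub> b"
    and rsmult_one [simp]:
      "x \<in> carrier M \<Longrightarrow> x \<bullet>\<^bsub>M\<^esub> \<one> = x"

text \<open>The quotient \<open>R/I\<close> by a right ideal. The unused fields \<^const>\<open>mult\<close> and
  \<^const>\<open>one\<close> are left unspecified. Scalar multiplication is
  \<open>(I + x) r = I + x r\<close>, written without choosing a representative; see
  \<open>quot_module_rsmult\<close> below.\<close>

definition quot_module ::
    "('a, 'r) ring_scheme \<Rightarrow> 'a set \<Rightarrow> ('a, 'a set) right_module"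
  where "quot_module R I =
    \<lparr>carrier = a_rcosets\<^bsub>R\<^esub> I, mult = undefined, one = undefined,
     zero = I, add = set_add R,
     rsmult = (\<lambda>X r. \<Union>x\<in>X. I +>\<^bsub>R\<^esub> (x \<otimes>\<^bsub>R\<^esub> r))\<rparr>"

definition right_ann ::
    "('a, 'r) ring_scheme \<Rightarrow> ('a, 'b, 'm) right_module_scheme \<Rightarrow> 'b \<Rightarrow> 'a set"
  where "right_ann R M m = {r \<in> carrier R. m \<bullet>\<^bsub>M\<^esub> r = \<zero>\<^bsub>M\<^esub>}"

definition point_annihilator ::
    "('a, 'r) ring_scheme \<Rightarrow> ('a, 'b, 'm) right_module_scheme \<Rightarrow> 'a set \<Rightarrow> bool"
  where "point_annihilator R M I \<longleftrightarrow>
    (\<exists>m \<in> carrier M. m \<noteq> \<zero>\<^bsub>M\<^esub> \<and> I = right_ann R M m)"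

definition point_annihilator_set ::
    "('a, 'r) ring_scheme \<Rightarrow> 'a set set \<Rightarrow> ('a, 'b, 'm) right_module_scheme set \<Rightarrow> bool"
  where "point_annihilator_set R S C \<longleftrightarrow>
    S \<subseteq> right_ideals R \<and> (\<forall>M \<in> C. right_module R M) \<and>
    (\<forall>M \<in> C. carrier M \<noteq> {\<zero>\<^bsub>M\<^esub>} \<longrightarrow> (\<exists>I \<in> S. point_annihilator R M I))"

text \<open>The right ideal \<open>a\<inverse>I\<close>; no invertibility of \<open>a\<close> is meant.\<close>

definition inv_ideal :: "('a, 'r) ring_scheme \<Rightarrow> 'a \<Rightarrow> 'a set \<Rightarrow> 'a set"
  where "inv_ideal R a I = {r \<in> carrier R. a \<otimes>\<^bsub>R\<^esub> r \<in> I}"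

definition right_oka_family :: "('a, 'r) ring_scheme \<Rightarrow> 'a set set \<Rightarrow> bool"
  where "right_oka_family R F \<longleftrightarrow>
    F \<subseteq> right_ideals R \<and> carrier R \<in> F \<and>
    (\<forall>a \<in> carrier R. \<forall>I \<in> right_ideals R.
       I <+>\<^bsub>R\<^esub> (a <#\<^bsub>R\<^esub> carrier R) \<in> F \<longrightarrow> inv_ideal R a I \<in> F \<longrightarrow> I \<in> F)"

definition semifilter :: "('a, 'r) ring_scheme \<Rightarrow> 'a set set \<Rightarrow> bool"
  where "semifilter R F0 \<longleftrightarrow>
    F0 \<subseteq> right_ideals R \<and>
    (\<forall>J \<in> F0. \<forall>I \<in> right_ideals R. J \<subseteq> I \<longrightarrow> I \<in> F0)"

definition compl_family :: "('a, 'r) ring_scheme \<Rightarrow> 'a set set \<Rightarrow> 'a set set"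
  where "compl_family R F = right_ideals R - F"

definition max_members :: "'a set set \<Rightarrow> 'a set set"
  where "max_members G = {I \<in> G. \<forall>K \<in> G. I \<subseteq> K \<longrightarrow> K = I}"

lemma right_ideal_abelian_subgroup:
  assumes "right_ideal I R"
  shows "abelian_subgroup I R"
proof -
  interpret right_ideal I R by (fact assms)
  show ?thesis
    by (rule abelian_subgroupI3) (unfold_locales)
qed

lemma quot_module_rsmult:
  assumes I: "right_ideal I R" and x: "x \<in> carrier R" and r: "r \<in> carrier R"
  shows "(I +>\<^bsub>R\<^esub> x) \<bullet>\<^bsub>quot_module R I\<^esub> r = I +>\<^bsub>R\<^esub> (x \<otimes>\<^bsub>R\<^esub> r)"
proof -
  interpret right_ideal I R by (fact I)
  interpret abelian_subgroup I R by (rule right_ideal_abelian_subgroup[OF I])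
  have *: "I +>\<^bsub>R\<^esub> (y \<otimes>\<^bsub>R\<^esub> r) = I +>\<^bsub>R\<^esub> (x \<otimes>\<^bsub>R\<^esub> r)" if y: "y \<in> I +>\<^bsub>R\<^esub> x" for y
  proof -
    from y obtain i where i: "i \<in> I" "y = i \<oplus>\<^bsub>R\<^esub> x"
      by (auto simp: a_r_coset_def')
    then have "y \<otimes>\<^bsub>R\<^esub> r = (i \<otimes>\<^bsub>R\<^esub> r) \<oplus>\<^bsub>R\<^esub> (x \<otimes>\<^bsub>R\<^esub> r)"
      using x r by (simp add: l_distr)
    moreover have "i \<otimes>\<^bsub>R\<^esub> r \<in> I" using i r by (simp add: I_r_closed)
    ultimately have "y \<otimes>\<^bsub>R\<^esub> r \<in> I +>\<^bsub>R\<^esub> (x \<otimes>\<^bsub>R\<^esub> r)"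
      by (auto simp: a_r_coset_def')
    then show ?thesis
      using a_repr_independence'[of "y \<otimes>\<^bsub>R\<^esub> r" "x \<otimes>\<^bsub>R\<^esub> r"] x r by auto
  qed
  have "x \<in> I +>\<^bsub>R\<^esub> x" using x by (rule a_rcos_self)
  then have "(\<Union>y \<in> I +>\<^bsub>R\<^esub> x. I +>\<^bsub>R\<^esub> (y \<otimes>\<^bsub>R\<^esub> r)) = I +>\<^bsub>R\<^esub> (x \<otimes>\<^bsub>R\<^esub> r)"
    by (rule UN_constant_eq) (intro ballI *)
  then show ?thesis by (simp add: quot_module_def)
qed

lemma quot_module_right_module:
  assumes I: "right_ideal I R"
  shows "right_module R (quot_module R I)"
proof -
  interpret right_ideal I R by (fact I)
  interpret abelian_subgroup I R by (rule right_ideal_abelian_subgroup[OF I])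
  let ?M = "quot_module R I"
  have carr: "carrier ?M = a_rcosets\<^bsub>R\<^esub> I" and add: "add ?M = set_add R"
    and zero: "\<zero>\<^bsub>?M\<^esub> = I" by (simp_all add: quot_module_def)
  have el: "\<exists>x\<in>carrier R. X = I +>\<^bsub>R\<^esub> x" if "X \<in> carrier ?M" for X
    using that by (auto simp: carr A_RCOSETS_def')
  have cl: "I +>\<^bsub>R\<^esub> x \<in> carrier ?M" if "x \<in> carrier R" for x
    using that by (auto simp: carr A_RCOSETS_def')
  have "comm_group (add_monoid ?M)"
    using a_factorgroup_is_comm_group
    unfolding comm_group_def group_def group_axioms_def comm_monoid_def monoid_def
      comm_monoid_axioms_def Units_def A_FactGroup_def'
    by (simp (no_asm_use) only: partial_object.simps monoid.simps carr add zero)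
  then have M: "abelian_group ?M"
    by (simp add: abelian_group_def abelian_group_axioms_def abelian_monoid_def comm_group_def)
  note smult = quot_module_rsmult[OF I]
  show ?thesis
  proof (intro right_module.intro right_module_axioms.intro ring_axioms M)
    fix X a assume "X \<in> carrier ?M" and a: "a \<in> carrier R"
    then obtain x where x: "x \<in> carrier R" and X: "X = I +>\<^bsub>R\<^esub> x" using el by blast
    show "X \<bullet>\<^bsub>?M\<^esub> a \<in> carrier ?M"
      using x a by (simp only: X smult cl m_closed)
  next
    fix X a b assume "X \<in> carrier ?M" and ab: "a \<in> carrier R" "b \<in> carrier R"
    then obtain x where x: "x \<in> carrier R" and X: "X = I +>\<^bsub>R\<^esub> x" using el by blast
    show "X \<bullet>\<^bsub>?M\<^esub> (a \<oplus>\<^bsub>R\<^esub> b) = X \<bullet>\<^bsub>?M\<^esub> a \<oplus>\<^bsub>?M\<^esub> X \<bullet>\<^bsub>?M\<^esub> b"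
      using x ab by (simp only: X smult add a_rcos_sum r_distr add.m_closed m_closed)
    show "X \<bullet>\<^bsub>?M\<^esub> (a \<otimes>\<^bsub>R\<^esub> b) = (X \<bullet>\<^bsub>?M\<^esub> a) \<bullet>\<^bsub>?M\<^esub> b"
      using x ab by (simp only: X smult m_assoc m_closed)
  next
    fix X Y a assume "X \<in> carrier ?M" "Y \<in> carrier ?M" and a: "a \<in> carrier R"
    then obtain x y where xy: "x \<in> carrier R" "y \<in> carrier R"
      and X: "X = I +>\<^bsub>R\<^esub> x" and Y: "Y = I +>\<^bsub>R\<^esub> y" using el[of X] el[of Y] by blast
    show "(X \<oplus>\<^bsub>?M\<^esub> Y) \<bullet>\<^bsub>?M\<^esub> a = X \<bullet>\<^bsub>?M\<^esub> a \<oplus>\<^bsub>?M\<^esub> Y \<bullet>\<^bsub>?M\<^esub> a"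
      using xy a by (simp only: X Y smult add a_rcos_sum l_distr add.m_closed m_closed)
  next
    fix X assume "X \<in> carrier ?M"
    then obtain x where x: "x \<in> carrier R" and X: "X = I +>\<^bsub>R\<^esub> x" using el by blast
    show "X \<bullet>\<^bsub>?M\<^esub> \<one>\<^bsub>R\<^esub> = X"
      using x by (simp only: X smult one_closed r_one)
  qed
qed

end

theory Submission
  imports Defs
begin

text \<open>If \<open>I\<close> is maximal in \<open>F'\<close> and \<open>x \<notin> I\<close>, then \<open>I + xR\<close> lies in \<open>F\<close> by maximality, so the
  Oka condition keeps \<open>x\<inverse>I\<close>, the annihilator of \<open>I + x\<close> in \<open>R/I\<close>, out of \<open>F\<close>. Hence the nonzero
  module \<open>R/I\<close> has no point annihilator in \<open>F\<close>. By Zorn's lemma every member of \<open>F'\<close> lies below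
  such an \<open>I\<close>, and a semifilter containing the former contains the latter. Parts (2) and (3) are
  part (1) for the semifilters of right ideals (properly) containing \<open>J\<close>, respectively of all
  right ideals.\<close>

lemma mem_right_ideals: "I \<in> right_ideals R \<longleftrightarrow> right_ideal I R"
  by (simp add: right_ideals_def)

text \<open>With \<open>right_ideal_principal\<close>, this makes I + xR a right ideal, so that
  maximality of I in \<open>compl_family R F\<close> can be tested against it.\<close>

lemma (in ring) right_ideal_add:
  assumes "right_ideal I R" "right_ideal J R"
  shows "right_ideal (I <+>\<^bsub>R\<^esub> J) R"
proof -
  interpret I: right_ideal I R by fact
  interpret J: right_ideal J R by fact
  show ?thesis
  proof (intro right_ideal.intro right_ideal_axioms.intro ring_axioms)
    show "additive_subgroup (I <+>\<^bsub>R\<^esub> J) R"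
      by (intro add_additive_subgroups I.additive_subgroup_axioms J.additive_subgroup_axioms)
  next
    fix a x assume "a \<in> I <+>\<^bsub>R\<^esub> J" and x: "x \<in> carrier R"
    then obtain i j where ij: "i \<in> I" "j \<in> J" "a = i \<oplus> j"
      by (auto simp: set_add_def')
    then have "a \<otimes> x = i \<otimes> x \<oplus> j \<otimes> x"
      using x by (simp add: l_distr)
    moreover have "i \<otimes> x \<in> I" "j \<otimes> x \<in> J"
      using ij x by (simp_all add: I.I_r_closed J.I_r_closed)
    ultimately show "a \<otimes> x \<in> I <+>\<^bsub>R\<^esub> J"
      unfolding set_add_def' by blast
  qed
qed

lemma (in ring) right_ideal_principal:
  assumes a: "a \<in> carrier R"
  shows "right_ideal (a <# carrier R) R"
proof (intro right_ideal.intro right_ideal_axioms.intro ring_axioms additive_subgroup.intro)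
  have mem: "y \<in> a <# carrier R \<longleftrightarrow> (\<exists>r \<in> carrier R. y = a \<otimes> r)" for y
    by (auto simp: l_coset_def)
  show "subgroup (a <# carrier R) (add_monoid R)"
  proof (rule add.subgroupI)
    show "a <# carrier R \<subseteq> carrier R" "a <# carrier R \<noteq> {}"
      using a by (auto simp: l_coset_def)
    fix y assume "y \<in> a <# carrier R"
    then obtain r where r: "r \<in> carrier R" "y = a \<otimes> r" by (auto simp: mem)
    then show "\<ominus> y \<in> a <# carrier R"
      using a by (auto simp: mem r_minus intro!: bexI[of _ "\<ominus> r"])
    fix z assume "z \<in> a <# carrier R"
    then obtain s where s: "s \<in> carrier R" "z = a \<otimes> s" by (auto simp: mem)
    show "y \<oplus> z \<in> a <# carrier R"
      using a r s by (auto simp: mem r_distr intro!: bexI[of _ "r \<oplus> s"])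
  qed
  fix y x assume "y \<in> a <# carrier R" and x: "x \<in> carrier R"
  then obtain r where "r \<in> carrier R" "y = a \<otimes> r" by (auto simp: mem)
  then show "y \<otimes> x \<in> a <# carrier R"
    using a x by (auto simp: mem m_assoc intro!: bexI[of _ "r \<otimes> x"])
qed

context right_ideal
begin

lemma a_r_coset_eq_iff:
  assumes "x \<in> carrier R"
  shows "I +> x = I \<longleftrightarrow> x \<in> I"
proof -
  interpret abelian_subgroup I R
    by (rule right_ideal_abelian_subgroup) (rule right_ideal_axioms)
  show ?thesis
    using assms a_rcos_const a_rcos_self by blast
qed

text \<open>For x outside I the two facts make I + xR strictly larger than I, which is what an
  appeal to maximality needs.\<close>

lemma add_principal_superset:
  assumes x: "x \<in> carrier R"
  shows "I \<subseteq> I <+>\<^bsub>R\<^esub> (x <# carrier R)" and "x \<in> I <+>\<^bsub>R\<^esub> (x <# carrier R)"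
proof -
  show "I \<subseteq> I <+>\<^bsub>R\<^esub> (x <# carrier R)"
  proof
    fix i assume i: "i \<in> I"
    then have "i = i \<oplus> x \<otimes> \<zero>" using x by simp
    then show "i \<in> I <+>\<^bsub>R\<^esub> (x <# carrier R)"
      using i by (auto simp: set_add_def' l_coset_def)
  qed
  have "x = \<zero> \<oplus> x \<otimes> \<one>" using x by simp
  then show "x \<in> I <+>\<^bsub>R\<^esub> (x <# carrier R)"
    using zero_closed by (force simp: set_add_def' l_coset_def)
qed

lemma right_ann_quot_module:
  assumes x: "x \<in> carrier R"
  shows "right_ann R (quot_module R I) (I +> x) = inv_ideal R x I"
  unfolding right_ann_def inv_ideal_def
proof (rule Collect_cong, rule conj_cong[OF refl])
  fix r assume r: "r \<in> carrier R"
  show "(I +> x) \<bullet>\<^bsub>quot_module R I\<^esub> r = \<zero>\<^bsub>quot_module R I\<^esub> \<longleftrightarrow> x \<otimes> r \<in> I"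
    \<comment> \<open>The scalar action is rewritten while \<open>quot_module\<close> is still
      folded, since unfolding would expose the union that defines \<open>rsmult\<close>. Only
      afterwards is the zero of the quotient unfolded to I.\<close>
    using x r by (simp add: quot_module_rsmult[OF right_ideal_axioms] a_r_coset_eq_iff)
      (simp add: quot_module_def a_r_coset_eq_iff)
qed

text \<open>Elements of R/I are cosets I + x, nonzero exactly when x is outside I. This turns point
  annihilators of R/I into the right ideals that occur in the Oka condition.\<close>

lemma point_annihilator_quot_module:
  "point_annihilator R (quot_module R I) K \<longleftrightarrow> (\<exists>x \<in> carrier R - I. K = inv_ideal R x I)"
proof -
  have "carrier (quot_module R I) = (\<lambda>x. I +> x) ` carrier R"
    by (auto simp: quot_module_def A_RCOSETS_def')
  moreover have "\<zero>\<^bsub>quot_module R I\<^esub> = I"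
    by (simp add: quot_module_def)
  ultimately show ?thesis
    by (auto simp: point_annihilator_def a_r_coset_eq_iff right_ann_quot_module)
qed

lemma quot_module_nonzero:
  assumes "I \<noteq> carrier R"
  shows "carrier (quot_module R I) \<noteq> {\<zero>\<^bsub>quot_module R I\<^esub>}"
proof -
  obtain x where x: "x \<in> carrier R" "x \<notin> I"
    using assms a_subset by blast
  then have "I +> x \<noteq> I" by (simp add: a_r_coset_eq_iff)
  moreover have "I +> x \<in> carrier (quot_module R I)"
    using x by (auto simp: quot_module_def A_RCOSETS_def')
  ultimately show ?thesis
    by (auto simp: quot_module_def)
qed

end

lemma max_member_no_point_annihilator:
  assumes oka: "right_oka_family R F" and I: "I \<in> max_members (compl_family R F)"
    and K: "point_annihilator R (quot_module R I) K"
  shows "K \<notin> F"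
proof
  assume "K \<in> F"
  have IR: "I \<in> right_ideals R" and "I \<notin> F"
    and max: "\<And>L. L \<in> right_ideals R \<Longrightarrow> L \<notin> F \<Longrightarrow> I \<subseteq> L \<Longrightarrow> L = I"
    using I by (auto simp: max_members_def compl_family_def)
  interpret right_ideal I R using IR by (simp add: mem_right_ideals)
  obtain x where x: "x \<in> carrier R" "x \<notin> I" and Kx: "K = inv_ideal R x I"
    using K by (auto simp: point_annihilator_quot_module)
  let ?L = "I <+>\<^bsub>R\<^esub> (x <#\<^bsub>R\<^esub> carrier R)"
  have "?L \<in> right_ideals R"
    using x by (simp add: mem_right_ideals right_ideal_add right_ideal_axioms right_ideal_principal)
  moreover have "I \<subseteq> ?L" "?L \<noteq> I"
    using add_principal_superset[of x] x by auto
  ultimately have "?L \<in> F" using max by blast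
  then have "I \<in> F"
    using oka x IR \<open>K \<in> F\<close> Kx by (auto simp: right_oka_family_def)
  with \<open>I \<notin> F\<close> show False ..
qed

text \<open>Applied to the quotients by members of Max(F') in F0, this shows that the hypothesis of
  part (1) can hold only if there are no such members.\<close>

lemma no_max_member_if_point_annihilator_set:
  assumes oka: "right_oka_family R F" and I: "I \<in> max_members (compl_family R F)"
    and pas: "point_annihilator_set R F C"
  shows "quot_module R I \<notin> C"
proof
  assume C: "quot_module R I \<in> C"
  \<comment> \<open>An Oka family contains R itself, so I is proper and R/I is nonzero; only nonzero
    modules are promised a point annihilator in F.\<close>
  have "I \<in> right_ideals R" "I \<noteq> carrier R"
    using I oka by (auto simp: max_members_def compl_family_def right_oka_family_def)
  then have "carrier (quot_module R I) \<noteq> {\<zero>\<^bsub>quot_module R I\<^esub>}"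
    by (intro right_ideal.quot_module_nonzero) (simp_all add: mem_right_ideals)
  then obtain K where "K \<in> F" "point_annihilator R (quot_module R I) K"
    using pas C unfolding point_annihilator_set_def by blast
  then show False
    using max_member_no_point_annihilator[OF oka I] by blast
qed

lemma ex_max_member_above:
  assumes chain: "\<And>C. subset.chain G C \<Longrightarrow> C \<noteq> {} \<Longrightarrow> \<exists>U \<in> G. \<forall>I \<in> C. I \<subseteq> U"
    and J: "J \<in> G"
  shows "\<exists>I \<in> max_members G. J \<subseteq> I"
proof -
  \<comment> \<open>Zorn's lemma is applied to the members of G above J rather than to G, so that
    the maximal element it yields contains J.\<close>
  have "\<exists>M \<in> {K \<in> G. J \<subseteq> K}. \<forall>X \<in> {K \<in> G. J \<subseteq> K}. M \<subseteq> X \<longrightarrow> X = M"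
  proof (rule subset_Zorn)
    fix C assume C: "subset.chain {K \<in> G. J \<subseteq> K} C"
    show "\<exists>U \<in> {K \<in> G. J \<subseteq> K}. \<forall>X \<in> C. X \<subseteq> U"
    proof (cases "C = {}")
      \<comment> \<open>The hypothesis \<open>chain\<close> says nothing about the empty chain; J
        bounds it.\<close>
      case True
      then show ?thesis using J by auto
    next
      case False
      moreover have "subset.chain G C"
        using C by (auto simp: subset.chain_def)
      ultimately have "\<exists>U \<in> G. \<forall>I \<in> C. I \<subseteq> U"
        by (intro chain)
      then obtain U where U: "U \<in> G" "\<forall>I \<in> C. I \<subseteq> U"
        by blast
      \<comment> \<open>Any member X of the chain transfers J \<subseteq> X to the bound U, which
        \<open>chain\<close> only places in G.\<close>
      obtain X where "X \<in> C" using False by blast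
      then have "J \<subseteq> X" "X \<subseteq> U"
        using C U by (auto simp: subset.chain_def)
      then show ?thesis using U by blast
    qed
  qed
  then obtain M where M: "M \<in> G" "J \<subseteq> M"
    and max: "\<And>X. X \<in> G \<Longrightarrow> J \<subseteq> X \<Longrightarrow> M \<subseteq> X \<Longrightarrow> X = M"
    by auto
  \<comment> \<open>Whatever contains M also contains J, so maximality above J is maximality in
    G.\<close>
  have "M \<in> max_members G"
    using M(1) max[OF _ subset_trans[OF M(2)]] by (simp add: max_members_def)
  then show ?thesis using M(2) by (rule rev_bexI)
qed

lemma semifilter_subset_oka_family:
  assumes oka: "right_oka_family R F"
    and chain: "\<And>C. subset.chain (compl_family R F) C \<Longrightarrow> C \<noteq> {} \<Longrightarrow>
                  \<exists>U \<in> compl_family R F. \<forall>I \<in> C. I \<subseteq> U"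
    and F0: "semifilter R F0"
    and pas: "point_annihilator_set R F
                {quot_module R I | I. I \<in> max_members (compl_family R F) \<inter> F0}"
  shows "F0 \<subseteq> F"
proof
  fix J assume J: "J \<in> F0"
  show "J \<in> F"
  proof (rule ccontr)
    assume "J \<notin> F"
    then have "J \<in> compl_family R F"
      using J F0 by (auto simp: compl_family_def semifilter_def)
    then have "\<exists>I \<in> max_members (compl_family R F). J \<subseteq> I"
      by (intro ex_max_member_above chain)
    then obtain I where I: "I \<in> max_members (compl_family R F)" "J \<subseteq> I"
      by blast
    then have "I \<in> F0"
      using J F0 by (auto simp: max_members_def compl_family_def semifilter_def)
    with I no_max_member_if_point_annihilator_set[OF oka I(1) pas] show False
      by blast
  qed
qed

theorem theorem4p1:
  fixes R :: "('a, 'r) ring_scheme" and F :: "'a set set"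
  assumes "ring R"
    and "right_oka_family R F"
    and "\<And>C. subset.chain (compl_family R F) C \<Longrightarrow> C \<noteq> {} \<Longrightarrow>
           \<exists>U \<in> compl_family R F. \<forall>I \<in> C. I \<subseteq> U"
  shows
    "(\<forall>F0. semifilter R F0 \<longrightarrow>
        point_annihilator_set R F
          {quot_module R I | I. I \<in> max_members (compl_family R F) \<inter> F0} \<longrightarrow>
        F0 \<subseteq> F)
     \<and>
     (\<forall>J \<in> right_ideals R.
        (point_annihilator_set R F
           {quot_module R I | I. I \<in> max_members (compl_family R F) \<and> J \<subseteq> I} \<longrightarrow>
         (\<forall>I \<in> right_ideals R. J \<subseteq> I \<longrightarrow> I \<in> F))
        \<and>
        (point_annihilator_set R F
           {quot_module R I | I. I \<in> max_members (compl_family R F) \<and> J \<subset> I} \<longrightarrow>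
         (\<forall>I \<in> right_ideals R. J \<subset> I \<longrightarrow> I \<in> F)))
     \<and>
     (point_annihilator_set R F
        {quot_module R I | I. I \<in> max_members (compl_family R F)} \<longrightarrow>
      F = right_ideals R)"
proof (intro conjI allI ballI impI)
  show main: "F0 \<subseteq> F" if "semifilter R F0"
    and "point_annihilator_set R F
           {quot_module R I | I. I \<in> max_members (compl_family R F) \<inter> F0}" for F0
    using assms(2) _ that by (rule semifilter_subset_oka_family) (rule assms(3))
  \<comment> \<open>The predicate \<open>P\<close> covers the remaining claims at once: it becomes J
    \<subseteq> I, J \<subset> I and constant truth. Its upward closure is what makes
    \<open>?F0\<close> a semifilter.\<close>
  have upset: "I \<in> F"
    if pas: "point_annihilator_set R F
               {quot_module R I | I. I \<in> max_members (compl_family R F) \<and> P I}"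
      and up: "\<And>K L. P K \<Longrightarrow> K \<subseteq> L \<Longrightarrow> P L"
      and I: "I \<in> right_ideals R" "P I"
    for P :: "'a set \<Rightarrow> bool" and I
  proof -
    let ?F0 = "{I \<in> right_ideals R. P I}"
    have "semifilter R ?F0"
      using up by (auto simp: semifilter_def)
    \<comment> \<open>Members of Max(F') are already right ideals, so the class of modules in
      \<open>pas\<close> is the one that \<open>main\<close> expects for \<open>?F0\<close>.\<close>
    moreover have "I \<in> max_members (compl_family R F) \<and> P I \<longleftrightarrow>
        I \<in> max_members (compl_family R F) \<inter> ?F0" for I
      by (auto simp: max_members_def compl_family_def)
    ultimately have "?F0 \<subseteq> F"
      using main[of ?F0] pas by simp
    then show ?thesis using I by blast
  qed
  show "I \<in> F" if "point_annihilator_set R F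
      {quot_module R I | I. I \<in> max_members (compl_family R F) \<and> J \<subseteq> I}"
    and "I \<in> right_ideals R" "J \<subseteq> I" for I J
    \<comment> \<open>The premise left open is upward closure of \<open>P\<close>, here transitivity
      of inclusion.\<close>
    using that(1) _ that(2,3) by (rule upset) auto
  show "I \<in> F" if "point_annihilator_set R F
      {quot_module R I | I. I \<in> max_members (compl_family R F) \<and> J \<subset> I}"
    and "I \<in> right_ideals R" "J \<subset> I" for I J
    using that(1) _ that(2,3) by (rule upset) auto
  show "F = right_ideals R" if "point_annihilator_set R F
      {quot_module R I | I. I \<in> max_members (compl_family R F)}"
  proof
    show "F \<subseteq> right_ideals R"
      using assms(2) by (simp add: right_oka_family_def)
    show "right_ideals R \<subseteq> F"
      using upset[of "\<lambda>_. True"] that by auto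
  qed
qed

end
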